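(* Let $G$ be a simple graph and let $u,v\in V(G)$ with $\mathrm{dis}(u,v)=2$. Then $\mathbf{a}_4(G)\ge \mathbf{a}_4(G_{u\rightarrow v})$, and the inequality is strict if $\mathbf{N}_G(\bar{u},v)\neq\emptyset$ and $\mathbf{N}_G(u,\bar{v})\neq\emptyset$.
   Context: All graphs are finite, simple and undirected. For a graph $G$ on $n$ vertices with adjacency matrix $\mathbf{A}(G)$, write $\det(\lambda I-\mathbf{A}(G))=\sum_{i=0}^n \mathbf{a}_i(G)\lambda^{n-i}$; $\mathbf{a}_4(G)$ is the coefficient of $\lambda^{n-4}$ (equivalently, $\mathbf{a}_4(G)$ equals the number of $2$-matchings of $G$ minus twice the number of $4$-cycles of $G$ plus a term $-2c_3$-free contribution only from $4$-vertex Sachs subgraphs; for the purposes here it is the coefficient just defined). $\mathrm{dis}(u,v)$ is the distance between $u$ and $v$. For vertices $u,v$: $\mathbf{N}_G(u,\bar v)=\{x\in V(G)\setminus\{u,v\}: xu\in E(G),\ xv\notin E(G)\}$ and $\mathbf{N}_G(\bar u,v)=\{x\in V(G)\setminus\{u,v\}: xu\notin E(G),\ xv\in E(G)\}$. The compression $G_{u\rightarrow v}$ is the graph obtained from $G$ by deleting all edges between $u$ and $\mathbf{N}_G(u,\bar v)$ and adding all edges from $v$ to $\mathbf{N}_G(u,\bar v)$. *)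

theory Defs
  imports
    "Graph_Theory.Pair_Digraph"
    "Graph_Theory.Shortest_Path"
    "Jordan_Normal_Form.Char_Poly"
begin

(* A finite simple undirected graph is a pair_graph: a finite, loop-free, symmetric
   relation, where the edge xy is represented by the two arcs (x,y) and (y,x). *)

definition dis :: "'a pair_pre_digraph \<Rightarrow> 'a \<Rightarrow> 'a \<Rightarrow> ereal" where
  "dis G u v = wf_digraph.\<mu> (with_proj G) (\<lambda>_. 1) u v"

definition adj_mat :: "'a pair_pre_digraph \<Rightarrow> 'a list \<Rightarrow> real mat" where
  "adj_mat G vs = mat (length vs) (length vs)
     (\<lambda>(i, j). if (vs ! i, vs ! j) \<in> parcs G then 1 else 0)"

(* Matrices are indexed by numbers, so a vertex enumeration has to be chosen; the choice
   is immaterial by graph_char_poly_enum below. *)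
definition graph_char_poly :: "'a pair_pre_digraph \<Rightarrow> real poly" where
  "graph_char_poly G = char_poly (adj_mat G (SOME vs. distinct vs \<and> set vs = pverts G))"

(* The coefficient of x^(n-i); the guard matters because n - i is truncated for i > n. *)
definition char_coeff :: "'a pair_pre_digraph \<Rightarrow> nat \<Rightarrow> real" where
  "char_coeff G i =
     (if i \<le> card (pverts G) then coeff (graph_char_poly G) (card (pverts G) - i) else 0)"

(* excl_nbrs G u v is N(u, not v), the neighbours of u that are not neighbours of v;
   accordingly N(not u, v) is excl_nbrs G v u. *)
definition excl_nbrs :: "'a pair_pre_digraph \<Rightarrow> 'a \<Rightarrow> 'a \<Rightarrow> 'a set" where
  "excl_nbrs G u v = {x \<in> pverts G - {u, v}. (x, u) \<in> parcs G \<and> (x, v) \<notin> parcs G}"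

definition compression :: "'a pair_pre_digraph \<Rightarrow> 'a \<Rightarrow> 'a \<Rightarrow> 'a pair_pre_digraph" where
  "compression G u v = (let N = excl_nbrs G u v in
     \<lparr> pverts = pverts G,
       parcs = (parcs G - ({u} \<times> N \<union> N \<times> {u})) \<union> ({v} \<times> N \<union> N \<times> {v}) \<rparr>)"

lemma pair_graph_compression:
  assumes "pair_graph G" "v \<in> pverts G"
  shows "pair_graph (compression G u v)"
proof -
  interpret pair_graph G by fact
  show ?thesis
  proof unfold_locales
    show "finite (parcs (compression G u v))"
      using pair_finite_verts pair_finite_arcs
      by (auto simp: compression_def Let_def excl_nbrs_def)
    show "symmetric (with_proj (compression G u v))"
      by (auto simp: symmetric_def sym_def compression_def Let_def intro: arcs_symmetric)
  qed (use assms(2) in \<open>auto simp: compression_def Let_def excl_nbrs_def pair_finite_verts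
        dest: in_arcsD1 in_arcsD2 no_loops'\<close>)
qed

lemma char_poly_adj_mat_enum:
  assumes "distinct vs" "distinct ws" "set vs = set ws"
  shows "char_poly (adj_mat G vs) = char_poly (adj_mat G ws)"
proof -
  define n where "n = length vs"
  have lw: "length ws = n"
    using assms by (metis distinct_card n_def)
  have "\<forall>i<n. \<exists>k<n. ws ! k = vs ! i"
    using assms(3) lw unfolding n_def by (metis in_set_conv_nth nth_mem)
  then obtain p where p: "\<And>i. i < n \<Longrightarrow> p i < n \<and> ws ! (p i) = vs ! i"
    by metis
  have inj: "p i = p j \<longleftrightarrow> i = j" if "i < n" "j < n" for i j
    using p that assms(1) n_def nth_eq_iff_index_eq by metis
  define P where "P = mat n n (\<lambda>(i, j). if j = p i then 1 else 0 :: real)"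
  have P: "P \<in> carrier_mat n n" by (simp add: P_def)
  have A: "adj_mat G vs \<in> carrier_mat n n" "adj_mat G ws \<in> carrier_mat n n"
    by (auto simp: adj_mat_def n_def lw[unfolded n_def])
  have PP: "P * transpose_mat P = 1\<^sub>m n"
    by (rule eq_matI)
      (auto simp: P_def scalar_prod_def inj p if_distrib cong: if_cong intro!: sum.neutral)
  have PP': "transpose_mat P * P = 1\<^sub>m n"
    by (rule mat_mult_left_right_inverse[OF P _ PP]) (use P in auto)
  have M: "P * adj_mat G ws = mat n n (\<lambda>(i, j). adj_mat G ws $$ (p i, j))"
  proof (rule eq_matI)
    fix i j assume "i < dim_row (mat n n (\<lambda>(i, j). adj_mat G ws $$ (p i, j)))"
      "j < dim_col (mat n n (\<lambda>(i, j). adj_mat G ws $$ (p i, j)))"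
    then have ij: "i < n" "j < n" by auto
    have "(P * adj_mat G ws) $$ (i, j) = (\<Sum>k = 0..<n. P $$ (i, k) * adj_mat G ws $$ (k, j))"
      using ij P A by (auto simp: scalar_prod_def)
    also have "\<dots> = (\<Sum>k = 0..<n. if k = p i then adj_mat G ws $$ (k, j) else 0)"
      by (rule sum.cong) (use ij in \<open>auto simp: P_def\<close>)
    also have "\<dots> = adj_mat G ws $$ (p i, j)"
      using p ij by auto
    finally show "(P * adj_mat G ws) $$ (i, j) = mat n n (\<lambda>(i, j). adj_mat G ws $$ (p i, j)) $$ (i, j)"
      using ij by simp
  qed (use P A in auto)
  have "adj_mat G vs = P * adj_mat G ws * transpose_mat P"
  proof (rule eq_matI)
    fix i j assume "i < dim_row (P * adj_mat G ws * transpose_mat P)"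
      "j < dim_col (P * adj_mat G ws * transpose_mat P)"
    then have ij: "i < n" "j < n" using P by auto
    have "(P * adj_mat G ws * transpose_mat P) $$ (i, j)
        = (\<Sum>k = 0..<n. adj_mat G ws $$ (p i, k) * P $$ (j, k))"
      unfolding M using ij P by (auto simp: scalar_prod_def)
    also have "\<dots> = (\<Sum>k = 0..<n. if k = p j then adj_mat G ws $$ (p i, k) else 0)"
      by (rule sum.cong) (use ij in \<open>auto simp: P_def\<close>)
    also have "\<dots> = adj_mat G ws $$ (p i, p j)"
      using p ij by auto
    also have "\<dots> = adj_mat G vs $$ (i, j)"
      using p ij lw by (simp add: adj_mat_def n_def[symmetric])
    finally show "adj_mat G vs $$ (i, j) = (P * adj_mat G ws * transpose_mat P) $$ (i, j)" ..
  qed (use P A in auto)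
  then have "similar_mat (adj_mat G vs) (adj_mat G ws)"
    using P A PP PP' by (intro similar_matI[of _ _ P "transpose_mat P" n]) auto
  then show ?thesis by (rule char_poly_similar)
qed

lemma graph_char_poly_enum:
  assumes "distinct vs" "set vs = pverts G"
  shows "graph_char_poly G = char_poly (adj_mat G vs)"
proof -
  let ?ws = "SOME vs. distinct vs \<and> set vs = pverts G"
  have "distinct ?ws \<and> set ?ws = pverts G"
    by (rule someI[of _ vs]) (use assms in blast)
  then show ?thesis
    using assms unfolding graph_char_poly_def by (intro char_poly_adj_mat_enum) auto
qed

end

theory Submission
  imports Defs "Jordan_Normal_Form.Schur_Decomposition"
begin

text \<open>
  Since the adjacency matrix \<open>A\<close> has trace 0, Newton's identities give
  \<open>a\<^sub>4 = (tr A\<^sup>2)\<^sup>2 / 8 - tr A\<^sup>4 / 4\<close>. Here \<open>tr A\<^sup>2\<close> counts arcs and is unchanged by the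
  compression, so it suffices that \<open>tr A\<^sup>4\<close>, the sum over all pairs \<open>(x, y)\<close> of the squared
  number of common neighbours of \<open>x\<close> and \<open>y\<close>, does not decrease. Distance 2 makes \<open>u\<close> and \<open>v\<close>
  distinct and non-adjacent, so the compression merely replaces the neighbourhoods of \<open>u\<close> and \<open>v\<close> by
  their intersection and their union. For \<open>x, y\<close> outside \<open>{u, v}\<close> the number of common neighbours
  can only grow; for the pairs \<open>(u, y)\<close> and \<open>(v, y)\<close> the sum of the two numbers is kept and they move
  apart, which increases the sum of squares. The pairs \<open>(u, u)\<close> and \<open>(v, v)\<close> alone contribute
  twice the product of the sizes of the two exclusive neighbourhoods, whence strictness.
\<close>

section \<open>Traces of powers under similarity and triangularity\<close>

definition mat_trace :: "'a::comm_monoid_add mat \<Rightarrow> 'a" where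
  "mat_trace A = (\<Sum>i<dim_row A. A $$ (i, i))"

lemma mat_trace_mult_comm:
  fixes A B :: "'a::comm_semiring_0 mat"
  assumes "A \<in> carrier_mat n m" "B \<in> carrier_mat m n"
  shows "mat_trace (A * B) = mat_trace (B * A)"
proof -
  have "mat_trace (A * B) = (\<Sum>i<n. \<Sum>j<m. A $$ (i, j) * B $$ (j, i))"
    using assms by (auto simp: mat_trace_def scalar_prod_def atLeast0LessThan intro!: sum.cong)
  also have "\<dots> = (\<Sum>j<m. \<Sum>i<n. B $$ (j, i) * A $$ (i, j))"
    by (subst sum.swap) (simp add: mult.commute)
  also have "\<dots> = mat_trace (B * A)"
    using assms by (auto simp: mat_trace_def scalar_prod_def atLeast0LessThan intro!: sum.cong)
  finally show ?thesis .
qed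

text \<open>Similarity passes to powers, and cyclicity of the trace brings \<open>P\<close> next to
  \<open>Q\<close>, where the two cancel.\<close>

lemma mat_trace_similar_pow:
  fixes A B :: "'a::comm_ring_1 mat"
  assumes "A \<in> carrier_mat n n" "similar_mat A B"
  shows "mat_trace (A ^\<^sub>m k) = mat_trace (B ^\<^sub>m k)"
proof -
  obtain P Q where "similar_mat_wit A B P Q"
    using assms(2) by (auto simp: similar_mat_def)
  then have w: "similar_mat_wit (A ^\<^sub>m k) (B ^\<^sub>m k) P Q"
    by (rule similar_mat_wit_pow)
  have c: "A ^\<^sub>m k \<in> carrier_mat n n"
    using assms(1) by simp
  note D = similar_mat_witD2[OF c w]
  have "mat_trace (A ^\<^sub>m k) = mat_trace (P * (B ^\<^sub>m k * Q))"
    using D by (simp add: assoc_mult_mat[of _ n n _ n _ n])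
  also have "\<dots> = mat_trace (B ^\<^sub>m k * Q * P)"
    by (rule mat_trace_mult_comm[of _ n n]) (use D in auto)
  also have "B ^\<^sub>m k * Q * P = B ^\<^sub>m k"
    using D by (simp add: assoc_mult_mat[of _ n n _ n _ n] right_mult_one_mat[of _ n n])
  finally show ?thesis .
qed

lemma upper_triangular_mult:
  fixes A B :: "'a::semiring_0 mat"
  assumes A: "A \<in> carrier_mat n n" "upper_triangular A"
    and B: "B \<in> carrier_mat n n" "upper_triangular B"
  shows "upper_triangular (A * B)"
    and "i < n \<Longrightarrow> (A * B) $$ (i, i) = A $$ (i, i) * B $$ (i, i)"
proof -
  \<comment> \<open>On or below the diagonal a summand survives only for \<open>j = k = i\<close>:
    if \<open>k < i\<close>, the left factor vanishes; otherwise \<open>j < k\<close>, and the right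
    one does.\<close>
  have z: "A $$ (i, k) * B $$ (k, j) = 0" if "i < n" "k < n" "j \<le> i" "k \<noteq> i \<or> j \<noteq> i" for i j k
  proof (cases "k < i")
    case True
    then show ?thesis using A that upper_triangularD[OF A(2), of k i] by simp
  next
    case False
    then have "j < k" using that by auto
    then show ?thesis using B that upper_triangularD[OF B(2), of j k] by simp
  qed
  have e: "(A * B) $$ (i, j) = (\<Sum>k<n. A $$ (i, k) * B $$ (k, j))" if "i < n" "j < n" for i j
    using that A B by (simp add: scalar_prod_def atLeast0LessThan)
  show "upper_triangular (A * B)"
  proof
    fix i j assume "j < i" "i < dim_row (A * B)"
    then show "(A * B) $$ (i, j) = 0"
      using A by (subst e) (auto intro!: sum.neutral z)
  qed
  show "(A * B) $$ (i, i) = A $$ (i, i) * B $$ (i, i)" if "i < n"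
  proof -
    have "(A * B) $$ (i, i) = (\<Sum>k\<in>{i}. A $$ (i, k) * B $$ (k, i))"
      unfolding e[OF that that] by (rule sum.mono_neutral_right) (use that z in auto)
    then show ?thesis by simp
  qed
qed

lemma upper_triangular_pow:
  fixes A :: "'a::semiring_1 mat"
  assumes A: "A \<in> carrier_mat n n" "upper_triangular A"
  shows "upper_triangular (A ^\<^sub>m k) \<and> (\<forall>i<n. (A ^\<^sub>m k) $$ (i, i) = (A $$ (i, i)) ^ k)"
proof (induction k)
  case 0
  then show ?case using A by auto
next
  case (Suc k)
  have "A ^\<^sub>m k \<in> carrier_mat n n"
    using A by simp
  from upper_triangular_mult[OF this _ A] Suc show ?case
    by (simp add: power_commutes)
qed

lemma mat_trace_pow_upper_triangular:
  fixes A :: "'a::semiring_1 mat"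
  assumes A: "A \<in> carrier_mat n n" "upper_triangular A"
  shows "mat_trace (A ^\<^sub>m k) = (\<Sum>a\<leftarrow>diag_mat A. a ^ k)"
proof -
  have "mat_trace (A ^\<^sub>m k) = (\<Sum>i<n. (A $$ (i, i)) ^ k)"
    using A upper_triangular_pow[OF A, of k] by (simp add: mat_trace_def)
  also have "\<dots> = (\<Sum>a\<leftarrow>diag_mat A. a ^ k)"
    using A by (simp add: diag_mat_def o_def interv_sum_list_conv_sum_set_nat atLeast0LessThan)
  finally show ?thesis .
qed

section \<open>Newton's identities and the fourth coefficient\<close>

text \<open>The reflected polynomial has the coefficient of \<open>x\<^sup>n\<^sup>-\<^sup>k\<close> at position \<open>k\<close>, without truncated
  subtraction, and is multiplicative, so Newton's identities follow by adding one root at a time.\<close>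

lemma newton_reflect_poly_coeffs:
  fixes as :: "'a::idom list"
  defines "p \<equiv> \<lambda>k. \<Sum>a\<leftarrow>as. a ^ k"
    and "e \<equiv> coeff (reflect_poly (\<Prod>a\<leftarrow>as. [:- a, 1:]))"
  shows "e 0 = 1"
    and "e 1 = - p 1"
    and "2 * e 2 = p 1 ^ 2 - p 2"
    and "6 * e 3 = - (p 1 ^ 3) + 3 * p 1 * p 2 - 2 * p 3"
    and "24 * e 4 = p 1 ^ 4 - 6 * p 1 ^ 2 * p 2 + 3 * p 2 ^ 2 + 8 * p 1 * p 3 - 6 * p 4"
proof -
  have "e 0 = 1 \<and> e 1 = - p 1 \<and> 2 * e 2 = p 1 ^ 2 - p 2
    \<and> 6 * e 3 = - (p 1 ^ 3) + 3 * p 1 * p 2 - 2 * p 3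
    \<and> 24 * e 4 = p 1 ^ 4 - 6 * p 1 ^ 2 * p 2 + 3 * p 2 ^ 2 + 8 * p 1 * p 3 - 6 * p 4"
    unfolding p_def e_def
  proof (induction as)
    case Nil
    then show ?case by simp
  next
    case (Cons x as)
    define q where "q = reflect_poly (\<Prod>a\<leftarrow>as. [:- a, 1:])"
    define s where "s k = (\<Sum>a\<leftarrow>as. a ^ k)" for k
    have r: "reflect_poly [:- x, 1:] = [:1, - x:]"
      by (simp add: reflect_poly_def)
    \<comment> \<open>A new root \<open>x\<close> multiplies the reflected polynomial by
      \<open>[:1, - x:]\<close>, so each coefficient loses \<open>x\<close> times its
      predecessor.\<close>
    have c: "reflect_poly (\<Prod>a\<leftarrow>x # as. [:- a, 1:]) = q + pCons 0 (Polynomial.smult (- x) q)"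
      unfolding list.map prod_list.Cons reflect_poly_mult r q_def by simp
    have IH: "coeff q 0 = 1" "coeff q 1 = - s 1" "2 * coeff q 2 = s 1 ^ 2 - s 2"
      "6 * coeff q 3 = - (s 1 ^ 3) + 3 * s 1 * s 2 - 2 * s 3"
      "24 * coeff q 4 = s 1 ^ 4 - 6 * s 1 ^ 2 * s 2 + 3 * s 2 ^ 2 + 8 * s 1 * s 3 - 6 * s 4"
      using Cons.IH unfolding q_def s_def by blast+
    have S: "(\<Sum>a\<leftarrow>x # as. a ^ k) = x ^ k + s k" for k
      by (simp add: s_def)
    have Q: "coeff (q + pCons 0 (Polynomial.smult (- x) q)) 0 = coeff q 0"
      "coeff (q + pCons 0 (Polynomial.smult (- x) q)) 1 = coeff q 1 - x * coeff q 0"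
      "coeff (q + pCons 0 (Polynomial.smult (- x) q)) 2 = coeff q 2 - x * coeff q 1"
      "coeff (q + pCons 0 (Polynomial.smult (- x) q)) 3 = coeff q 3 - x * coeff q 2"
      "coeff (q + pCons 0 (Polynomial.smult (- x) q)) 4 = coeff q 4 - x * coeff q 3"
      by (simp_all add: coeff_pCons numeral_eq_Suc)
    \<comment> \<open>Without division only the multiples 2, 6 and 24 of the coefficients are known;
      each subtracted term is regrouped to show the multiple that the induction hypothesis
      covers.\<close>
    have "2 * (coeff q 2 - x * coeff q 1) = 2 * coeff q 2 - 2 * x * coeff q 1"
      by (simp add: algebra_simps)
    also have "\<dots> = (x + s 1) ^ 2 - (x ^ 2 + s 2)"
      unfolding IH by (simp add: eval_nat_numeral algebra_simps)
    finally have "2 * (coeff q 2 - x * coeff q 1) = (x + s 1) ^ 2 - (x ^ 2 + s 2)" .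
    moreover have "6 * (coeff q 3 - x * coeff q 2)
        = - ((x + s 1) ^ 3) + 3 * (x + s 1) * (x ^ 2 + s 2) - 2 * (x ^ 3 + s 3)"
    proof -
      have "6 * (coeff q 3 - x * coeff q 2) = 6 * coeff q 3 - 3 * x * (2 * coeff q 2)"
        by (simp add: algebra_simps)
      then show ?thesis
        unfolding IH by (simp add: eval_nat_numeral algebra_simps)
    qed
    moreover have "24 * (coeff q 4 - x * coeff q 3)
        = (x + s 1) ^ 4 - 6 * (x + s 1) ^ 2 * (x ^ 2 + s 2) + 3 * (x ^ 2 + s 2) ^ 2
          + 8 * (x + s 1) * (x ^ 3 + s 3) - 6 * (x ^ 4 + s 4)"
    proof -
      have "24 * (coeff q 4 - x * coeff q 3) = 24 * coeff q 4 - 4 * x * (6 * coeff q 3)"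
        by (simp add: algebra_simps)
      then show ?thesis
        unfolding IH by (simp add: eval_nat_numeral algebra_simps)
    qed
    ultimately show ?case
      unfolding c S Q using IH by simp
  qed
  then show "e 0 = 1" "e 1 = - p 1" "2 * e 2 = p 1 ^ 2 - p 2"
    "6 * e 3 = - (p 1 ^ 3) + 3 * p 1 * p 2 - 2 * p 3"
    "24 * e 4 = p 1 ^ 4 - 6 * p 1 ^ 2 * p 2 + 3 * p 2 ^ 2 + 8 * p 1 * p 3 - 6 * p 4"
    by blast+
qed

text \<open>Schur triangularisation puts the eigenvalues on a diagonal, so their power sums are the
  traces of the powers. As the first power sum vanishes, only two terms of Newton's identity
  remain.\<close>

lemma char_poly_coeff_4_trace:
  fixes A :: "complex mat"
  assumes A: "A \<in> carrier_mat n n" and "mat_trace A = 0"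
  shows "24 * coeff (reflect_poly (char_poly A)) 4
    = 3 * mat_trace (A ^\<^sub>m 2) ^ 2 - 6 * mat_trace (A ^\<^sub>m 4)"
proof -
  obtain as where "char_poly A = (\<Prod>a\<leftarrow>as. [:- a, 1:])"
    using char_poly_factorized[OF A] by blast
  from schur_decomposition_exists[OF A this] obtain B
    where B: "B \<in> carrier_mat n n" "upper_triangular B" "similar_mat A B"
    by blast
  have t: "mat_trace (A ^\<^sub>m k) = (\<Sum>a\<leftarrow>diag_mat B. a ^ k)" for k
    using mat_trace_similar_pow[OF A B(3)] mat_trace_pow_upper_triangular[OF B(1,2)] by simp
  have "A ^\<^sub>m 1 = A"
    using A by simp
  then have "(\<Sum>a\<leftarrow>diag_mat B. a ^ 1) = 0"
    using t[of 1] assms(2) by simp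
  then show ?thesis
    using newton_reflect_poly_coeffs(5)[of "diag_mat B"]
    unfolding t char_poly_similar[OF B(3)] char_poly_upper_triangular[OF B(1,2)] by simp
qed

lemma mat_trace_map_of_real:
  "mat_trace (map_mat complex_of_real A) = of_real (mat_trace A)" if "A \<in> carrier_mat n n"
  using that by (simp add: mat_trace_def)

text \<open>The embedding into the complex numbers, where the characteristic polynomial splits,
  commutes with powers, traces and characteristic polynomials.\<close>

lemma real_char_poly_coeff_4_trace:
  fixes A :: "real mat"
  assumes A: "A \<in> carrier_mat n n" and "mat_trace A = 0"
  shows "24 * coeff (reflect_poly (char_poly A)) 4
    = 3 * mat_trace (A ^\<^sub>m 2) ^ 2 - 6 * mat_trace (A ^\<^sub>m 4)"
proof -
  let ?C = "map_mat complex_of_real A"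
  have C: "?C \<in> carrier_mat n n" using A by simp
  have t: "mat_trace (?C ^\<^sub>m k) = of_real (mat_trace (A ^\<^sub>m k))" for k
    using mat_trace_map_of_real[of "A ^\<^sub>m k" n] A by (simp add: of_real_hom.mat_hom_pow)
  have "mat_trace ?C = 0"
    using mat_trace_map_of_real[OF A] assms(2) by simp
  from char_poly_coeff_4_trace[OF C this]
  have "24 * complex_of_real (coeff (reflect_poly (char_poly A)) 4)
    = 3 * of_real (mat_trace (A ^\<^sub>m 2)) ^ 2 - 6 * of_real (mat_trace (A ^\<^sub>m 4))"
    unfolding t of_real_hom.char_poly_hom[OF A]
    by (simp add: coeff_reflect_poly coeff_map_poly degree_map_poly split: if_splits)
  then have "complex_of_real (24 * coeff (reflect_poly (char_poly A)) 4)
    = of_real (3 * mat_trace (A ^\<^sub>m 2) ^ 2 - 6 * mat_trace (A ^\<^sub>m 4))"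
    by simp
  then show ?thesis by (simp only: of_real_eq_iff)
qed

section \<open>Walks of length 2 in a graph\<close>

definition adj :: "'a pair_pre_digraph \<Rightarrow> 'a \<Rightarrow> 'a \<Rightarrow> real" where
  "adj G x y = (if (x, y) \<in> parcs G then 1 else 0)"

text \<open>An entry of the square of the matrix \<open>a\<close>; for \<open>adj G\<close> it is
  the number of common neighbours. A weight function in place of a graph permits arithmetic with 0/1
  indicators.\<close>

definition walks2 :: "'a set \<Rightarrow> ('a \<Rightarrow> 'a \<Rightarrow> real) \<Rightarrow> 'a \<Rightarrow> 'a \<Rightarrow> real" where
  "walks2 V a x y = (\<Sum>z\<in>V. a x z * a z y)"

lemma walks2_sym:
  assumes "\<And>x y. x \<in> V \<Longrightarrow> y \<in> V \<Longrightarrow> a x y = a y x" "x \<in> V" "y \<in> V"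
  shows "walks2 V a x y = walks2 V a y x"
  using assms unfolding walks2_def by (intro sum.cong) (auto simp: mult.commute)

text \<open>The square of the adjacency matrix is symmetric, so the trace of the fourth power is the
  sum of its squared entries.\<close>

lemma char_coeff_4:
  assumes "pair_graph G"
  shows "24 * char_coeff G 4 = 3 * (\<Sum>x\<in>pverts G. walks2 (pverts G) (adj G) x x) ^ 2
    - 6 * (\<Sum>x\<in>pverts G. \<Sum>y\<in>pverts G. walks2 (pverts G) (adj G) x y ^ 2)"
proof -
  interpret pair_graph G by fact
  obtain vs where vs: "distinct vs" "set vs = pverts G"
    using finite_distinct_list[OF pair_finite_verts] by blast
  define n where "n = length vs"
  define A where "A = adj_mat G vs"
  have n: "n = card (pverts G)"
    using vs distinct_card n_def by metis
  have A: "A \<in> carrier_mat n n"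
    by (simp add: A_def adj_mat_def n_def)
  have Aij: "A $$ (i, j) = adj G (vs ! i) (vs ! j)" if "i < n" "j < n" for i j
    using that by (simp add: A_def adj_mat_def n_def adj_def)
  have re: "(\<Sum>i<n. f (vs ! i)) = (\<Sum>x\<in>pverts G. f x)" for f :: "'a \<Rightarrow> real"
    by (rule sum.reindex_bij_betw) (use bij_betw_nth[OF vs(1) refl] vs n_def in auto)
  have A2: "(A * A) $$ (i, j) = walks2 (pverts G) (adj G) (vs ! i) (vs ! j)" if "i < n" "j < n" for i j
    using A that by (simp add: scalar_prod_def atLeast0LessThan Aij walks2_def re[symmetric])
  have sym: "walks2 (pverts G) (adj G) x y = walks2 (pverts G) (adj G) y x"
    if "x \<in> pverts G" "y \<in> pverts G" for x y
    by (rule walks2_sym) (use that in \<open>auto simp: adj_def arcs_symmetric\<close>)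
  have "mat_trace A = 0"
    using A by (auto simp: mat_trace_def Aij adj_def dest: no_loops' intro!: sum.neutral)
  moreover have "mat_trace (A ^\<^sub>m 2) = (\<Sum>x\<in>pverts G. walks2 (pverts G) (adj G) x x)"
    using A by (simp add: numeral_2_eq_2 mat_trace_def A2 re[symmetric] del: index_mult_mat(1))
  moreover have "mat_trace (A ^\<^sub>m 4)
    = (\<Sum>x\<in>pverts G. \<Sum>y\<in>pverts G. walks2 (pverts G) (adj G) x y ^ 2)"
  proof -
    have sq: "(X * X) $$ (i, i) = (\<Sum>j<n. X $$ (i, j) * X $$ (j, i))"
      if "X \<in> carrier_mat n n" "i < n" for X :: "real mat" and i
      using that by (simp add: scalar_prod_def atLeast0LessThan)
    have "A ^\<^sub>m 4 = A * A * (A * A)"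
      using A by (simp add: numeral_eq_Suc assoc_mult_mat[of _ n n _ n _ n])
    then have "mat_trace (A ^\<^sub>m 4) = (\<Sum>i<n. \<Sum>j<n. (A * A) $$ (i, j) * (A * A) $$ (j, i))"
      using A sq[of "A * A"] by (simp add: mat_trace_def del: index_mult_mat(1))
    also have "\<dots> = (\<Sum>x\<in>pverts G. \<Sum>y\<in>pverts G.
        walks2 (pverts G) (adj G) x y * walks2 (pverts G) (adj G) y x)"
      by (simp add: A2 re[symmetric] del: index_mult_mat(1))
    also have "\<dots> = (\<Sum>x\<in>pverts G. \<Sum>y\<in>pverts G. walks2 (pverts G) (adj G) x y ^ 2)"
      by (intro sum.cong refl) (simp add: sym power2_eq_square)
    finally show ?thesis .
  qed
  \<comment> \<open>For fewer than 4 vertices both sides are 0: the left by the guard in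
    \<open>char_coeff\<close>, the right because 4 exceeds the degree.\<close>
  moreover have "char_coeff G 4 = coeff (reflect_poly (char_poly A)) 4"
    using degree_monic_char_poly[OF A] graph_char_poly_enum[OF vs]
    by (simp add: char_coeff_def coeff_reflect_poly n A_def[symmetric])
  ultimately show ?thesis
    using real_char_poly_coeff_4_trace[OF A] by simp
qed

section \<open>Effect of the compression on walks of length 2\<close>

text \<open>On 0/1 values, \<open>bu\<close> and \<open>bv\<close> express intersection and union of
  the two neighbourhoods, and \<open>\<alpha>\<close>, \<open>\<beta>\<close> are the sizes of the
  exclusive ones. Pairs are sorted by how many of their ends lie in \<open>{u, v}\<close>.\<close>

lemma walks2_compression:
  fixes a b :: "'a \<Rightarrow> 'a \<Rightarrow> real"
  assumes V: "finite V" "u \<in> V" "v \<in> V" "u \<noteq> v"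
    and a01: "\<And>x y. a x y = 0 \<or> a x y = 1"
    and asym: "\<And>x y. a x y = a y x"
    and bsym: "\<And>x y. b x y = b y x"
    and a0: "a u u = 0" "a u v = 0" "a v v = 0"
    and b0: "b u u = 0" "b u v = 0" "b v v = 0"
    and bW: "\<And>x y. x \<in> V - {u, v} \<Longrightarrow> y \<in> V - {u, v} \<Longrightarrow> b x y = a x y"
    and bu: "\<And>x. x \<in> V - {u, v} \<Longrightarrow> b u x = a u x * a v x"
    and bv: "\<And>x. x \<in> V - {u, v} \<Longrightarrow> b v x = a u x + a v x - a u x * a v x"
  defines "W \<equiv> V - {u, v}"
  defines "\<alpha> \<equiv> \<Sum>x\<in>W. a u x * (1 - a v x)" and "\<beta> \<equiv> \<Sum>x\<in>W. a v x * (1 - a u x)"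
  shows "(\<Sum>x\<in>V. walks2 V b x x) = (\<Sum>x\<in>V. walks2 V a x x)"
    and "(\<Sum>x\<in>V. \<Sum>y\<in>V. walks2 V b x y ^ 2) \<ge> (\<Sum>x\<in>V. \<Sum>y\<in>V. walks2 V a x y ^ 2) + 2 * \<alpha> * \<beta>"
proof -
  have split: "(\<Sum>x\<in>V. f x) = f u + f v + (\<Sum>x\<in>W. f x)" for f :: "'a \<Rightarrow> real"
  proof -
    have "V = insert u (insert v W)" "finite W" "u \<notin> W" "v \<notin> W"
      using V by (auto simp: W_def)
    then show ?thesis using V(4) by simp
  qed
  have vu: "a v u = 0" "b v u = 0"
    using a0 b0 asym[of u v] bsym[of u v] by auto
  note a' = a0 vu
  note b' = b0 vu bu[folded W_def] bv[folded W_def] bW[folded W_def]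
  have asq: "a x y * a x y = a x y" for x y
    using a01[of x y] by auto
  \<comment> \<open>The walks with middle vertex outside \<open>{u, v}\<close>; between ends in
    \<open>W\<close> they survive the compression unchanged.\<close>
  define R where "R x y = (\<Sum>z\<in>W. a x z * a z y)" for x y
  have R0: "R x y \<ge> 0" for x y
  proof -
    have "a x z * a z y \<ge> 0" for z
      using a01[of x z] a01[of z y] by auto
    then show ?thesis by (simp add: R_def sum_nonneg)
  qed
  have aWW: "walks2 V a x y = a u x * a u y + a v x * a v y + R x y" for x y
    by (simp add: walks2_def split asym[of x u] asym[of x v] R_def)
  have bWW: "walks2 V b x y = b u x * b u y + b v x * b v y + R x y" if "x \<in> W" "y \<in> W" for x y
    using that by (simp add: walks2_def split bsym[of x u] bsym[of x v] R_def bW[folded W_def])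
  have mono: "walks2 V a x y ^ 2 \<le> walks2 V b x y ^ 2" if "x \<in> W" "y \<in> W" for x y
  proof -
    \<comment> \<open>If \<open>u\<close> or \<open>v\<close> was a common neighbour of
      \<open>x\<close> and \<open>y\<close>, then \<open>v\<close> is one afterwards; if both were,
      both remain. Nonnegativity lets the inequality be squared.\<close>
    have "a u x * a u y + a v x * a v y \<le> b u x * b u y + b v x * b v y
        \<and> a u x * a u y + a v x * a v y \<ge> 0"
      using that a01[of u x] a01[of u y] a01[of v x] a01[of v y] by (auto simp: b')
    then show ?thesis
      unfolding aWW bWW[OF that] using R0[of x y] by (intro power_mono) auto
  qed
  have nonneg: "a x y * (1 - a x' y') * a z z' \<ge> 0" for x y x' y' z z'
    using a01[of x y] a01[of x' y'] a01[of z z'] by auto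
  \<comment> \<open>\<open>(p + r)\<^sup>2 + (q + r)\<^sup>2 + 2pq = r\<^sup>2 + (p + q + r)\<^sup>2\<close> for the weights \<open>p\<close>, \<open>q\<close>, \<open>r\<close> of the
    two exclusive neighbourhoods and of the common one\<close>
  have exch: "(\<Sum>x\<in>W. a u x * w x) ^ 2 + (\<Sum>x\<in>W. a v x * w x) ^ 2
      + 2 * (\<Sum>x\<in>W. a u x * (1 - a v x) * w x) * (\<Sum>x\<in>W. a v x * (1 - a u x) * w x)
      = (\<Sum>x\<in>W. b u x * w x) ^ 2 + (\<Sum>x\<in>W. b v x * w x) ^ 2" for w
  proof -
    define p where "p = (\<Sum>x\<in>W. a u x * (1 - a v x) * w x)"
    define q where "q = (\<Sum>x\<in>W. a v x * (1 - a u x) * w x)"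
    define r where "r = (\<Sum>x\<in>W. a u x * a v x * w x)"
    have "(\<Sum>x\<in>W. a u x * w x) = p + r" "(\<Sum>x\<in>W. a v x * w x) = q + r"
      "(\<Sum>x\<in>W. b u x * w x) = r" "(\<Sum>x\<in>W. b v x * w x) = p + q + r"
      unfolding p_def q_def r_def by (simp_all add: b' sum.distrib[symmetric] algebra_simps)
    then show ?thesis
      unfolding p_def[symmetric] q_def[symmetric] by (simp add: power2_eq_square algebra_simps)
  qed
  \<comment> \<open>There are no loops at \<open>u\<close>, \<open>v\<close> and no edge between
    them, so the middle vertex lies in \<open>W\<close>.\<close>
  have au: "walks2 V a u y = (\<Sum>x\<in>W. a u x * a x y)" "walks2 V a v y = (\<Sum>x\<in>W. a v x * a x y)" for y
    by (simp_all add: walks2_def split a')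
  have bu: "walks2 V b u y = (\<Sum>x\<in>W. b u x * b x y)" "walks2 V b v y = (\<Sum>x\<in>W. b v x * b x y)" for y
    by (simp_all add: walks2_def split b')
  have cross: "walks2 V a u y ^ 2 + walks2 V a v y ^ 2 \<le> walks2 V b u y ^ 2 + walks2 V b v y ^ 2"
    if y: "y \<in> W" for y
  proof -
    \<comment> \<open>These are the factors of the extra product in \<open>exch\<close> for the
      weight \<open>a x y\<close>, which can therefore be dropped.\<close>
    have "(\<Sum>x\<in>W. a u x * (1 - a v x) * a x y) \<ge> 0" "(\<Sum>x\<in>W. a v x * (1 - a u x) * a x y) \<ge> 0"
      by (simp_all add: sum_nonneg nonneg)
    then have "(\<Sum>x\<in>W. a u x * a x y) ^ 2 + (\<Sum>x\<in>W. a v x * a x y) ^ 2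
      \<le> (\<Sum>x\<in>W. b u x * a x y) ^ 2 + (\<Sum>x\<in>W. b v x * a x y) ^ 2"
      unfolding exch[symmetric] by simp
    moreover have "(\<Sum>x\<in>W. b u x * b x y) = (\<Sum>x\<in>W. b u x * a x y)"
      "(\<Sum>x\<in>W. b v x * b x y) = (\<Sum>x\<in>W. b v x * a x y)"
      using y by (simp_all add: b')
    ultimately show ?thesis
      unfolding au bu by simp
  qed
  have sa: "\<forall>x\<in>V. \<forall>y\<in>V. walks2 V a x y = walks2 V a y x"
    using walks2_sym[of V a] asym by blast
  have sb: "\<forall>x\<in>V. \<forall>y\<in>V. walks2 V b x y = walks2 V b y x"
    using walks2_sym[of V b] bsym by blast
  have auu: "walks2 V a u u = (\<Sum>x\<in>W. a u x)" "walks2 V a v v = (\<Sum>x\<in>W. a v x)"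
    by (simp_all add: au asym[of _ u] asym[of _ v] asq)
  have bsq: "b u x * b u x = b u x" "b v x * b v x = b v x" if "x \<in> W" for x
    using that a01[of u x] a01[of v x] by (auto simp: b')
  have buu: "walks2 V b u u = (\<Sum>x\<in>W. b u x)" "walks2 V b v v = (\<Sum>x\<in>W. b v x)"
    by (simp_all add: bu bsym[of _ u] bsym[of _ v] bsq)
  \<comment> \<open>For the constant weight 1 the extra product in \<open>exch\<close> is exactly
    \<open>2 * \<alpha> * \<beta>\<close>.\<close>
  have diag: "walks2 V a u u ^ 2 + walks2 V a v v ^ 2 + 2 * \<alpha> * \<beta>
      = walks2 V b u u ^ 2 + walks2 V b v v ^ 2"
    using exch[of "\<lambda>_. 1"] unfolding auu buu \<alpha>_def \<beta>_def by simp
  \<comment> \<open>The intersection lies inside the union, so \<open>u\<close> and \<open>v\<close>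
    keep their common neighbours.\<close>
  have uv: "walks2 V a u v = walks2 V b u v"
    unfolding au bu
  proof (rule sum.cong)
    fix x assume "x \<in> W"
    then show "a u x * a x v = b u x * b x v"
      using a01[of u x] a01[of v x] by (auto simp: asym[of x v] bsym[of x v] b')
  qed simp
  show "(\<Sum>x\<in>V. walks2 V b x x) = (\<Sum>x\<in>V. walks2 V a x x)"
  proof -
    \<comment> \<open>A vertex of \<open>W\<close> keeps its number of neighbours among
      \<open>u\<close> and \<open>v\<close>.\<close>
    have "walks2 V b x x = walks2 V a x x" if "x \<in> W" for x
      unfolding aWW bWW[OF that that]
      using that a01[of u x] a01[of v x] by (auto simp: b')
    moreover have "walks2 V b u u + walks2 V b v v = walks2 V a u u + walks2 V a v v"
      unfolding auu buu by (simp add: b' sum.distrib sum_subtractf)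
    ultimately show ?thesis
      unfolding split by simp
  qed
  have expand: "(\<Sum>x\<in>V. \<Sum>y\<in>V. F x y ^ 2) = F u u ^ 2 + F v v ^ 2 + 2 * F u v ^ 2
      + 2 * (\<Sum>y\<in>W. F u y ^ 2 + F v y ^ 2) + (\<Sum>x\<in>W. \<Sum>y\<in>W. F x y ^ 2)"
    if s: "\<forall>x\<in>V. \<forall>y\<in>V. F x y = F y x" for F :: "'a \<Rightarrow> 'a \<Rightarrow> real"
  proof -
    have "F x u = F u x" "F x v = F v x" if "x \<in> W" for x
      using that V s by (auto simp: W_def)
    then show ?thesis
      unfolding split using s V by (simp add: sum.distrib)
  qed
  have "(\<Sum>y\<in>W. walks2 V a u y ^ 2 + walks2 V a v y ^ 2)
      \<le> (\<Sum>y\<in>W. walks2 V b u y ^ 2 + walks2 V b v y ^ 2)"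
    by (intro sum_mono cross)
  moreover have "(\<Sum>x\<in>W. \<Sum>y\<in>W. walks2 V a x y ^ 2) \<le> (\<Sum>x\<in>W. \<Sum>y\<in>W. walks2 V b x y ^ 2)"
    by (intro sum_mono mono)
  ultimately show "(\<Sum>x\<in>V. \<Sum>y\<in>V. walks2 V b x y ^ 2)
      \<ge> (\<Sum>x\<in>V. \<Sum>y\<in>V. walks2 V a x y ^ 2) + 2 * \<alpha> * \<beta>"
    unfolding expand[of "walks2 V a", OF sa] expand[of "walks2 V b", OF sb] using diag uv by simp
qed

section \<open>Vertices at distance 2 and the inequality for graphs\<close>

text \<open>The empty walk or a single arc would cost less than the distance.\<close>

lemma dis_eq_2_imp:
  assumes "pair_graph G" "u \<in> pverts G" "dis G u v = 2"
  shows "u \<noteq> v" "(u, v) \<notin> parcs G"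
proof -
  interpret pair_graph G by fact
  have *: "\<not> awalk u p v" if "length p < 2" for p
  proof
    assume "awalk u p v"
    from min_cost_le_walk_cost[OF this, of "\<lambda>_. 1"]
    have "ereal 2 \<le> ereal (real (length p))"
      using assms(3) by (simp add: dis_def awalk_cost_def sum_list_triv)
    then show False using that by simp
  qed
  show "u \<noteq> v"
    using *[of "[]"] assms(2) by (auto simp: awalk_Nil_iff)
  show "(u, v) \<notin> parcs G"
    using *[of "[(u, v)]"] by (auto simp: awalk_Cons_iff awalk_Nil_iff dest: in_arcsD1 in_arcsD2)
qed

theorem theorem3p3:
  fixes G :: "'a pair_pre_digraph" and u v :: 'a
  assumes "pair_graph G"
    and "u \<in> pverts G" and "v \<in> pverts G"
    and "dis G u v = 2"
  shows "char_coeff G 4 \<ge> char_coeff (compression G u v) 4 \<and>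
    (excl_nbrs G v u \<noteq> {} \<and> excl_nbrs G u v \<noteq> {} \<longrightarrow>
      char_coeff G 4 > char_coeff (compression G u v) 4)"
proof -
  interpret pair_graph G by fact
  let ?H = "compression G u v"
  let ?V = "pverts G" and ?a = "adj G" and ?b = "adj ?H"
  \<comment> \<open>\<open>\<alpha> u v\<close> and \<open>\<alpha> v u\<close> become the
    \<open>\<alpha>\<close> and \<open>\<beta>\<close> of \<open>walks2_compression\<close>.\<close>
  define \<alpha> where "\<alpha> x y = (\<Sum>z\<in>?V - {u, v}. ?a x z * (1 - ?a y z))" for x y
  have H: "pair_graph ?H" using assms by (intro pair_graph_compression)
  interpret H: pair_graph ?H by fact
  have VH: "pverts ?H = ?V" by (simp add: compression_def Let_def)
  have uv: "u \<noteq> v" "(u, v) \<notin> parcs G" "(v, u) \<notin> parcs G"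
    using dis_eq_2_imp[OF assms(1,2,4)] arcs_symmetric by auto
  have sym: "?a x y = ?a y x" for x y
    by (auto simp: adj_def intro: arcs_symmetric)
  have symH: "?b x y = ?b y x" for x y
    using H.arcs_symmetric by (auto simp: adj_def)
  have b_uu: "?b u u = 0" "?b v v = 0"
    using H.no_loops' by (auto simp: adj_def)
  have b_uv: "?b u v = 0"
    using uv by (auto simp: adj_def compression_def Let_def excl_nbrs_def)
  have b_W: "?b x y = ?a x y" if "x \<in> ?V - {u, v}" "y \<in> ?V - {u, v}" for x y
    using that by (auto simp: adj_def compression_def Let_def)
  have s: "(x, y) \<in> parcs G \<longleftrightarrow> (y, x) \<in> parcs G" for x y
    by (auto intro: arcs_symmetric)
  have b_u: "?b u x = ?a u x * ?a v x" "?b v x = ?a u x + ?a v x - ?a u x * ?a v x"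
    if "x \<in> ?V - {u, v}" for x
    using that uv s[of x u] s[of x v] by (auto simp: adj_def compression_def Let_def excl_nbrs_def)
  note W = walks2_compression[of ?V u v ?a ?b, OF pair_finite_verts assms(2,3) uv(1) _ sym symH
      _ _ _ b_uu(1) b_uv b_uu(2) b_W b_u]
  have eq: "(\<Sum>x\<in>?V. walks2 ?V ?b x x) = (\<Sum>x\<in>?V. walks2 ?V ?a x x)"
    by (rule W) (use uv no_loops' in \<open>auto simp: adj_def\<close>)
  have le: "(\<Sum>x\<in>?V. \<Sum>y\<in>?V. walks2 ?V ?b x y ^ 2)
      \<ge> (\<Sum>x\<in>?V. \<Sum>y\<in>?V. walks2 ?V ?a x y ^ 2) + 2 * \<alpha> u v * \<alpha> v u"
    unfolding \<alpha>_def by (rule W) (use uv no_loops' in \<open>auto simp: adj_def\<close>)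
  \<comment> \<open>In \<open>char_coeff_4\<close> the squared terms cancel by \<open>eq\<close>;
    dividing the remaining factors 24 and 6 by 6 leaves 4 and 1.\<close>
  have diff: "4 * (char_coeff G 4 - char_coeff ?H 4) \<ge> 2 * \<alpha> u v * \<alpha> v u"
    using char_coeff_4[OF assms(1)] char_coeff_4[OF H] le unfolding VH eq by simp
  have nonneg: "?a x z * (1 - ?a y z) \<ge> 0" for x y z
    by (simp add: adj_def)
  have \<alpha>0: "\<alpha> x y \<ge> 0" for x y
    unfolding \<alpha>_def by (intro sum_nonneg nonneg)
  have pos: "\<alpha> x y > 0" if ne: "excl_nbrs G x y \<noteq> {}" and xy: "{x, y} = {u, v}" for x y
  proof -
    \<comment> \<open>An exclusive neighbour gives a summand 1, and no summand is negative.\<close>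
    obtain z where "z \<in> ?V - {u, v}" "(x, z) \<in> parcs G" "(y, z) \<notin> parcs G"
      using ne xy s by (auto simp: excl_nbrs_def)
    then show ?thesis
      unfolding \<alpha>_def using pair_finite_verts
      by (intro sum_pos2[of _ z]) (auto simp: adj_def)
  qed
  have "\<alpha> u v * \<alpha> v u \<ge> 0"
    using \<alpha>0 by simp
  moreover have "\<alpha> u v * \<alpha> v u > 0" if "excl_nbrs G v u \<noteq> {} \<and> excl_nbrs G u v \<noteq> {}"
    using that pos[of u v] pos[of v u] by (simp add: insert_commute)
  ultimately show ?thesis
    using diff by fastforce
qed

end
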